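(* Let $\mathcal{A}^{(1)},\dots,\mathcal{A}^{(L)}\in\mathbb{C}^{n_1\times n_2\times\cdots\times n_d}$, $\alpha_1,\dots,\alpha_L\in\mathbb{R}^{+}$, $1\le r\le n_i$ for $1\le i\le d$, and let $(\cdot)^{\dagger}$ denote either $(\cdot)^{H}$ or $(\cdot)^{T}$. The function $$f(U^{(1)},\dots,U^{(d)})=\sum_{\ell=1}^{L}\alpha_\ell\|\mathrm{diag}\{\mathcal{W}^{(\ell)}\}\|^2,\qquad \mathcal{W}^{(\ell)}=\mathcal{A}^{(\ell)}\bullet_1(U^{(1)})^{\dagger}\cdots\bullet_d(U^{(d)})^{\dagger},\qquad U^{(i)}\in\mathrm{St}(r,n_i,\mathbb{C}),$$ is restricted $\frac1\alpha$-homogeneous with $\alpha=\frac12$ and block multiconvex.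
   Context: $d>1$; $\mathrm{St}(r,n,\mathbb{C})=\{X\in\mathbb{C}^{n\times r}:X^{H}X=I_r\}$; $X^{T}$ and $X^{H}$ are transpose and conjugate transpose; $\mathbb{R}^{+}=[0,\infty)$. Mode product: for a tensor $\mathcal{A}\in\mathbb{C}^{n_1\times\cdots\times n_d}$ and $X\in\mathbb{C}^{m\times n_i}$, $(\mathcal{A}\bullet_iX)_{p_1\cdots q\cdots p_d}=\sum_{p_i}\mathcal{A}_{p_1\cdots p_i\cdots p_d}X_{qp_i}$ ($q$ in position $i$). $\mathrm{diag}\{\mathcal{W}\}=(\mathcal{W}_{1\cdots1},\dots,\mathcal{W}_{r\cdots r})^{T}$ for $\mathcal{W}\in\mathbb{C}^{r\times\cdots\times r}$. $\|\cdot\|$ is the Euclidean norm. $\langle X,Y\rangle_{\Re}=\Re\,\mathrm{tr}(X^{H}Y)$ is the real inner product on $\mathbb{C}^{n\times r}$ and $\nabla$ the Euclidean gradient with respect to it. For fixed $U^{(j)}\in\mathrm{St}(r,n_j,\mathbb{C})$, $j\ne i$, let $h_{(i)}(U)=f(U^{(1)},\dots,U^{(i-1)},U,U^{(i+1)},\dots,U^{(d)})$, extended to all $U\in\mathbb{C}^{n_i\times r}$ by the same formula. $f$ is restricted $\frac1\alpha$-homogeneous ($\alpha\in(0,1)$) if $h_{(i)}(U)=\alpha\langle U,\nabla h_{(i)}(U)\rangle_{\Re}$ for all $i$, all choices of the fixed blocks and all $U\in\mathrm{St}(r,n_i,\mathbb{C})$. $f$ is block multiconvex if $h_{(i)}$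 is convex for all $i$ and all choices of the fixed blocks. *)

theory Defs
  imports Complex_Main "Jordan_Normal_Form.Schur_Decomposition"
begin

section \<open>Complex matrices\<close>

text \<open>
  Matrices are those of \<open>Jordan_Normal_Form\<close>; there \<open>mat_adjoint X\<close> is the conjugate
  transpose. All indices (rows, columns, tensor modes, blocks) start at 0.
\<close>

definition mat_trace :: "complex mat \<Rightarrow> complex" where
  "mat_trace M = (\<Sum>i<dim_row M. M $$ (i, i))"

definition re_inner :: "complex mat \<Rightarrow> complex mat \<Rightarrow> real" where
  "re_inner X Y = Re (mat_trace (mat_adjoint X * Y))"

definition re_norm :: "complex mat \<Rightarrow> real" where
  "re_norm X = sqrt (re_inner X X)"

definition stiefel :: "nat \<Rightarrow> nat \<Rightarrow> complex mat set" where
  "stiefel r n = {X \<in> carrier_mat n r. mat_adjoint X * X = 1\<^sub>m r}"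

definition cvec_norm :: "complex vec \<Rightarrow> real" where
  "cvec_norm v = sqrt (\<Sum>k<dim_vec v. (cmod (v $ k))\<^sup>2)"


section \<open>Tensors\<close>

text \<open>
  A tensor with dimension list \<open>ns\<close> is a function on multi-indices, given as lists, that
  vanishes outside the index range; so tensors correspond exactly to arrays of shape \<open>ns\<close>.
\<close>

type_synonym tensor = "nat list \<Rightarrow> complex"

definition multi_indices :: "nat list \<Rightarrow> nat list set" where
  "multi_indices ns = {p. length p = length ns \<and> (\<forall>j<length ns. p ! j < ns ! j)}"

definition carrier_tensor :: "nat list \<Rightarrow> tensor set" where
  "carrier_tensor ns = {A. \<forall>p. p \<notin> multi_indices ns \<longrightarrow> A p = 0}"

definition mode_prod :: "nat \<Rightarrow> tensor \<Rightarrow> complex mat \<Rightarrow> tensor" where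
  "mode_prod i A X = (\<lambda>p. if p ! i < dim_row X
     then \<Sum>k<dim_col X. A (p[i := k]) * X $$ (p ! i, k) else 0)"

lemma mode_prod_carrier:
  assumes A: "A \<in> carrier_tensor ns" and i: "i < length ns"
    and X: "X \<in> carrier_mat m (ns ! i)"
  shows "mode_prod i A X \<in> carrier_tensor (ns[i := m])"
proof -
  have "mode_prod i A X p = 0" if p: "p \<notin> multi_indices (ns[i := m])" for p
  proof (cases "p ! i < m")
    case True
    have "p[i := k] \<notin> multi_indices ns" for k
    proof
      assume k: "p[i := k] \<in> multi_indices ns"
      then have len: "length p = length ns"
        and lt: "\<And>j. j < length ns \<Longrightarrow> p[i := k] ! j < ns ! j"
        by (auto simp: multi_indices_def)
      have "p ! j < ns[i := m] ! j" if "j < length ns" for j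
        using lt[OF that] True that len by (cases "j = i") auto
      then show False using p len by (auto simp: multi_indices_def)
    qed
    then show ?thesis using A by (simp add: mode_prod_def carrier_tensor_def)
  next
    case False
    then show ?thesis using X by (simp add: mode_prod_def)
  qed
  then show ?thesis by (simp add: carrier_tensor_def)
qed

text \<open>\<open>mode_prods A [X\<^sub>0, \<dots>, X\<^sub>d\<^sub>-\<^sub>1]\<close> applies \<open>X\<^sub>0\<close> along mode 0 first, then \<open>X\<^sub>1\<close> along mode 1, etc.\<close>

definition mode_prods :: "tensor \<Rightarrow> complex mat list \<Rightarrow> tensor" where
  "mode_prods A Xs = fold (\<lambda>i T. mode_prod i T (Xs ! i)) [0..<length Xs] A"

definition tensor_diag :: "nat \<Rightarrow> nat \<Rightarrow> tensor \<Rightarrow> complex vec" where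
  "tensor_diag d r W = vec r (\<lambda>k. W (replicate d k))"


section \<open>Gradient and convexity on the space of matrices\<close>

text \<open>
  Since \<open>complex mat\<close> is not an instance of the normed space classes, Frechet differentiability
  on \<open>carrier_mat n r\<close> is spelled out. The gradient \<open>G\<close> represents the derivative with respect
  to the real inner product.
\<close>

definition has_gradient ::
  "nat \<Rightarrow> nat \<Rightarrow> (complex mat \<Rightarrow> real) \<Rightarrow> complex mat \<Rightarrow> complex mat \<Rightarrow> bool" where
  "has_gradient n r h U G \<longleftrightarrow> G \<in> carrier_mat n r \<and>
     (\<forall>e>0. \<exists>\<delta>>0. \<forall>V \<in> carrier_mat n r. re_norm V < \<delta> \<longrightarrow>
        \<bar>h (U + V) - h U - re_inner G V\<bar> \<le> e * re_norm V)"

lemma re_inner_carrier: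
  assumes "X \<in> carrier_mat n r" "Y \<in> carrier_mat n r"
  shows "re_inner X Y = (\<Sum>j<r. \<Sum>i<n. Re (cnj (X $$ (i, j)) * Y $$ (i, j)))"
  using assms
  by (auto simp: re_inner_def mat_trace_def mat_adjoint_def scalar_prod_def atLeast0LessThan
      mat_of_rows_def intro!: sum.cong)

lemma has_gradient_unique:
  assumes G: "has_gradient n r h U G" and G': "has_gradient n r h U G'"
  shows "G = G'"
proof (rule ccontr)
  assume ne: "G \<noteq> G'"
  define W where "W = G - G'"
  have c: "G \<in> carrier_mat n r" "G' \<in> carrier_mat n r"
    using assms by (auto simp: has_gradient_def)
  then have W: "W \<in> carrier_mat n r" by (simp add: W_def minus_carrier_mat)
  have sq: "re_inner W W = (\<Sum>j<r. \<Sum>i<n. (cmod (W $$ (i, j)))\<^sup>2)"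
    unfolding re_inner_carrier[OF W W]
    by (intro sum.cong refl, unfold cmod_power2) (simp add: power2_eq_square)
  obtain a b where ab: "a < n" "b < r" "W $$ (a, b) \<noteq> 0"
  proof -
    obtain a b where "a < n" "b < r" "G $$ (a, b) \<noteq> G' $$ (a, b)"
      using ne c by (metis carrier_matD eq_matI)
    then show ?thesis using that c by (auto simp: W_def)
  qed
  have "0 < re_inner W W"
    unfolding sq using ab by (intro sum_pos2[of _ b] sum_pos2[of _ a] sum_nonneg) auto
  then have N: "0 < re_norm W" and NN: "re_inner W W = re_norm W * re_norm W"
    by (auto simp: re_norm_def)
  define e where "e = re_norm W / 4"
  have e: "0 < e" using N by (simp add: e_def)
  obtain d where d: "d > 0" "\<And>V. V \<in> carrier_mat n r \<Longrightarrow> re_norm V < d \<Longrightarrow>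
      \<bar>h (U + V) - h U - re_inner G V\<bar> \<le> e * re_norm V"
    using G e unfolding has_gradient_def by blast
  obtain d' where d': "d' > 0" "\<And>V. V \<in> carrier_mat n r \<Longrightarrow> re_norm V < d' \<Longrightarrow>
      \<bar>h (U + V) - h U - re_inner G' V\<bar> \<le> e * re_norm V"
    using G' e unfolding has_gradient_def by blast
  define t where "t = min d d' / (2 * re_norm W)"
  have t: "0 < t" using d d' N by (simp add: t_def)
  define V where "V = complex_of_real t \<cdot>\<^sub>m W"
  have V: "V \<in> carrier_mat n r" using W by (simp add: V_def)
  have "re_inner V V = t\<^sup>2 * re_inner W W"
    unfolding re_inner_carrier[OF V V] re_inner_carrier[OF W W] sum_distrib_left
    using W by (intro sum.cong refl) (auto simp: V_def power2_eq_square algebra_simps)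
  then have nV: "re_norm V = t * re_norm W"
    using t by (simp add: re_norm_def real_sqrt_mult)
  then have "re_norm V = min d d' / 2" using N by (simp add: t_def)
  then have "re_norm V < d" "re_norm V < d'" using d d' by auto
  then have *: "\<bar>re_inner G V - re_inner G' V\<bar> \<le> 2 * (e * re_norm V)"
    using d(2)[OF V] d'(2)[OF V] by linarith
  have "re_inner G V - re_inner G' V = t * re_inner W W"
    unfolding re_inner_carrier[OF c(1) V] re_inner_carrier[OF c(2) V] re_inner_carrier[OF W W]
      sum_distrib_left sum_subtractf[symmetric]
    using c W by (intro sum.cong refl) (auto simp: V_def W_def algebra_simps)
  with * nV NN t N have "t * re_norm W * re_norm W \<le> t * re_norm W * re_norm W / 2"
    by (simp add: e_def mult.assoc)
  moreover have "0 < t * re_norm W * re_norm W" using t N by simp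
  ultimately show False by linarith
qed

definition gradient :: "nat \<Rightarrow> nat \<Rightarrow> (complex mat \<Rightarrow> real) \<Rightarrow> complex mat \<Rightarrow> complex mat" where
  "gradient n r h U = (THE G. has_gradient n r h U G)"

lemma has_gradient_gradient: "has_gradient n r h U G \<Longrightarrow> gradient n r h U = G"
  unfolding gradient_def by (rule the_equality) (auto intro: has_gradient_unique)

definition mat_convex :: "nat \<Rightarrow> nat \<Rightarrow> (complex mat \<Rightarrow> real) \<Rightarrow> bool" where
  "mat_convex n r h \<longleftrightarrow> (\<forall>X \<in> carrier_mat n r. \<forall>Y \<in> carrier_mat n r. \<forall>u\<ge>0. \<forall>v\<ge>0. u + v = 1 \<longrightarrow>
     h (complex_of_real u \<cdot>\<^sub>m X + complex_of_real v \<cdot>\<^sub>m Y) \<le> u * h X + v * h Y)"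


section \<open>Functions of several Stiefel blocks\<close>

text \<open>
  \<open>fixed_blocks r ns i\<close> are the families whose blocks other than the \<open>i\<close>-th lie in the Stiefel
  manifolds; the \<open>i\<close>-th entry is a mere placeholder, overwritten in \<open>block_fun\<close>.
\<close>

definition fixed_blocks :: "nat \<Rightarrow> nat list \<Rightarrow> nat \<Rightarrow> complex mat list set" where
  "fixed_blocks r ns i = {Us. length Us = length ns \<and>
     (\<forall>j<length ns. j \<noteq> i \<longrightarrow> Us ! j \<in> stiefel r (ns ! j))}"

definition block_fun ::
  "(complex mat list \<Rightarrow> real) \<Rightarrow> nat \<Rightarrow> complex mat list \<Rightarrow> complex mat \<Rightarrow> real" where
  "block_fun f i Us = (\<lambda>U. f (Us[i := U]))"

text \<open>The property called "restricted \<open>1/\<alpha>\<close>-homogeneous", with differentiability made explicit.\<close>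

definition restricted_homogeneous ::
  "nat \<Rightarrow> nat list \<Rightarrow> real \<Rightarrow> (complex mat list \<Rightarrow> real) \<Rightarrow> bool" where
  "restricted_homogeneous r ns \<alpha> f \<longleftrightarrow> 0 < \<alpha> \<and> \<alpha> < 1 \<and>
     (\<forall>i<length ns. \<forall>Us \<in> fixed_blocks r ns i. \<forall>U \<in> stiefel r (ns ! i).
        let h = block_fun f i Us in
        (\<exists>G. has_gradient (ns ! i) r h U G) \<and>
        h U = \<alpha> * re_inner U (gradient (ns ! i) r h U))"

definition block_multiconvex ::
  "nat \<Rightarrow> nat list \<Rightarrow> (complex mat list \<Rightarrow> real) \<Rightarrow> bool" where
  "block_multiconvex r ns f \<longleftrightarrow>
     (\<forall>i<length ns. \<forall>Us \<in> fixed_blocks r ns i. mat_convex (ns ! i) r (block_fun f i Us))"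

text \<open>The parameter \<open>dag\<close> is either the conjugate transpose or the transpose.\<close>

definition diag_objective :: "(complex mat \<Rightarrow> complex mat) \<Rightarrow> nat \<Rightarrow> nat \<Rightarrow>
    (nat \<Rightarrow> real) \<Rightarrow> (nat \<Rightarrow> tensor) \<Rightarrow> complex mat list \<Rightarrow> real" where
  "diag_objective dag r L w A Us =
     (\<Sum>l<L. w l * (cvec_norm (tensor_diag (length Us) r (mode_prods (A l) (map dag Us))))\<^sup>2)"

end

theory Submission
  imports Defs
begin

text \<open>
  Once all blocks but \<open>U\<close> are fixed, multilinearity of the mode products makes every diagonal
  entry of the transformed tensor a linear form in \<open>dag U\<close>. If \<open>dag\<close> is the transpose this is a
  linear form in \<open>U\<close>; if it is the conjugate transpose, it is the conjugate of one, and conjugation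
  does not change the modulus. Hence, either way, each block function is a nonnegative combination
  of squared moduli \<open>\<bar>\<phi> U\<bar>\<^sup>2\<close> of complex linear forms, that is, a positive semidefinite real quadratic
  form in \<open>U\<close> (lemma \<open>block_fun_diag_objective\<close>).

  Such a form is convex because \<open>z \<mapsto> \<bar>z\<bar>\<^sup>2\<close> is. It is homogeneous of degree 2 in the real sense, so
  Euler's identity \<open>2 h U = \<langle>U, \<nabla>h U\<rangle>\<close> holds at every matrix \<open>U\<close>, in particular on the Stiefel
  manifold; this is the claim for \<open>\<alpha> = 1/2\<close>.
\<close>

section \<open>Sums of squared linear forms on matrices\<close>

definition lin_form :: "nat \<Rightarrow> nat \<Rightarrow> (nat \<Rightarrow> nat \<Rightarrow> complex) \<Rightarrow> complex mat \<Rightarrow> complex" where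
  "lin_form n r B U = (\<Sum>j<r. \<Sum>i<n. B i j * U $$ (i, j))"

lemma lin_form_lincomb:
  assumes "X \<in> carrier_mat n r" "Y \<in> carrier_mat n r"
  shows "lin_form n r B (u \<cdot>\<^sub>m X + v \<cdot>\<^sub>m Y) = u * lin_form n r B X + v * lin_form n r B Y"
  unfolding lin_form_def sum_distrib_left sum.distrib[symmetric]
  using assms by (intro sum.cong refl) (auto simp: algebra_simps)

lemma lin_form_add:
  assumes "X \<in> carrier_mat n r" "Y \<in> carrier_mat n r"
  shows "lin_form n r B (X + Y) = lin_form n r B X + lin_form n r B Y"
  unfolding lin_form_def sum.distrib[symmetric]
  using assms by (intro sum.cong refl) (auto simp: algebra_simps)

lemma re_inner_commute:
  assumes "X \<in> carrier_mat n r" "Y \<in> carrier_mat n r"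
  shows "re_inner X Y = re_inner Y X"
  unfolding re_inner_carrier[OF assms] re_inner_carrier[OF assms(2,1)]
  by (intro sum.cong refl) (simp add: mult.commute)

lemma re_norm_nonneg:
  assumes "X \<in> carrier_mat n r"
  shows "0 \<le> re_norm X"
  unfolding re_norm_def re_inner_carrier[OF assms assms]
  by (intro real_sqrt_ge_zero sum_nonneg) simp

lemma cmod_entry_le_re_norm:
  assumes X: "X \<in> carrier_mat n r" and "i < n" "j < r"
  shows "cmod (X $$ (i, j)) \<le> re_norm X"
proof -
  have sq: "Re (cnj z * z) = (cmod z)\<^sup>2" for z
    unfolding cmod_power2 by (simp add: power2_eq_square)
  have "(cmod (X $$ (i, j)))\<^sup>2 \<le> (\<Sum>a<n. (cmod (X $$ (a, j)))\<^sup>2)"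
    using \<open>i < n\<close> by (intro member_le_sum) auto
  also have "\<dots> \<le> (\<Sum>b<r. \<Sum>a<n. (cmod (X $$ (a, b)))\<^sup>2)"
    using \<open>j < r\<close> by (intro member_le_sum[where f = "\<lambda>b. \<Sum>a<n. (cmod (X $$ (a, b)))\<^sup>2"])
      (auto intro: sum_nonneg)
  also have "\<dots> = re_inner X X"
    unfolding re_inner_carrier[OF X X] sq ..
  finally show ?thesis
    unfolding re_norm_def by (rule real_le_rsqrt)
qed

lemma cmod_lin_form_le:
  assumes X: "X \<in> carrier_mat n r"
  shows "cmod (lin_form n r B X) \<le> (\<Sum>j<r. \<Sum>i<n. cmod (B i j)) * re_norm X"
  unfolding lin_form_def sum_distrib_right
  by (intro sum_norm_le) (auto simp: norm_mult intro!: mult_left_mono cmod_entry_le_re_norm[OF X])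

text \<open>
  In the application \<open>M\<close> consists of the pairs of a tensor and a diagonal position, so that both
  sums of the objective merge into one.
\<close>

definition square_sum :: "nat \<Rightarrow> nat \<Rightarrow> 'm set \<Rightarrow> ('m \<Rightarrow> real) \<Rightarrow> ('m \<Rightarrow> nat \<Rightarrow> nat \<Rightarrow> complex)
    \<Rightarrow> complex mat \<Rightarrow> real" where
  "square_sum n r M c B U = (\<Sum>m\<in>M. c m * (cmod (lin_form n r (B m) U))\<^sup>2)"

definition square_sum_grad :: "nat \<Rightarrow> nat \<Rightarrow> 'm set \<Rightarrow> ('m \<Rightarrow> real) \<Rightarrow> ('m \<Rightarrow> nat \<Rightarrow> nat \<Rightarrow> complex)
    \<Rightarrow> complex mat \<Rightarrow> complex mat" where
  "square_sum_grad n r M c B U = mat n r (\<lambda>(i, j).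
     \<Sum>m\<in>M. complex_of_real (2 * c m) * (cnj (B m i j) * lin_form n r (B m) U))"

lemma square_sum_grad_carrier: "square_sum_grad n r M c B U \<in> carrier_mat n r"
  by (simp add: square_sum_grad_def)

text \<open>
  Up to the factor 2, pairing with the gradient is the symmetric real bilinear form whose diagonal
  is the quadratic form itself.
\<close>

lemma re_inner_square_sum_grad:
  assumes V: "V \<in> carrier_mat n r"
  shows "re_inner (square_sum_grad n r M c B U) V =
    (\<Sum>m\<in>M. 2 * c m * Re (cnj (lin_form n r (B m) U) * lin_form n r (B m) V))"
proof -
  have "cnj (square_sum_grad n r M c B U $$ (i, j)) * V $$ (i, j) = (\<Sum>m\<in>M.
      complex_of_real (2 * c m) * (cnj (lin_form n r (B m) U) * (B m i j * V $$ (i, j))))"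
    if "i < n" "j < r" for i j
    unfolding square_sum_grad_def using that
    by (simp add: sum_distrib_right) (simp only: mult_ac)
  then have "re_inner (square_sum_grad n r M c B U) V = Re (\<Sum>j<r. \<Sum>i<n. \<Sum>m\<in>M.
      complex_of_real (2 * c m) * (cnj (lin_form n r (B m) U) * (B m i j * V $$ (i, j))))"
    unfolding re_inner_carrier[OF square_sum_grad_carrier V] Re_sum
    by (intro sum.cong refl) (simp only: Re_sum lessThan_iff)
  also have "(\<Sum>j<r. \<Sum>i<n. \<Sum>m\<in>M.
      complex_of_real (2 * c m) * (cnj (lin_form n r (B m) U) * (B m i j * V $$ (i, j)))) =
    (\<Sum>j<r. \<Sum>m\<in>M. \<Sum>i<n.
      complex_of_real (2 * c m) * (cnj (lin_form n r (B m) U) * (B m i j * V $$ (i, j))))"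
    by (intro sum.cong refl sum.swap)
  also have "\<dots> = (\<Sum>m\<in>M. \<Sum>j<r. \<Sum>i<n.
      complex_of_real (2 * c m) * (cnj (lin_form n r (B m) U) * (B m i j * V $$ (i, j))))"
    by (rule sum.swap)
  also have "\<dots> = (\<Sum>m\<in>M.
      complex_of_real (2 * c m) * (cnj (lin_form n r (B m) U) * lin_form n r (B m) V))"
    by (simp add: lin_form_def sum_distrib_left)
  finally show ?thesis by (simp add: mult.assoc)
qed

text \<open>
  A quadratic form satisfies \<open>h (U + V) = h U + \<langle>\<nabla>h U, V\<rangle> + h V\<close> exactly, so differentiability
  only requires that the remainder \<open>h V\<close> be bounded by a multiple of the squared norm of \<open>V\<close>.
\<close>

lemma has_gradient_square_sum:
  assumes U: "U \<in> carrier_mat n r"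
  shows "has_gradient n r (square_sum n r M c B) U (square_sum_grad n r M c B U)"
proof -
  let ?h = "square_sum n r M c B"
  let ?G = "square_sum_grad n r M c B U"
  let ?\<phi> = "\<lambda>m. lin_form n r (B m)"
  have rest: "?h (U + V) - ?h U - re_inner ?G V = ?h V" if V: "V \<in> carrier_mat n r" for V
  proof -
    have sq: "(cmod (x + y))\<^sup>2 = (cmod x)\<^sup>2 + 2 * Re (cnj x * y) + (cmod y)\<^sup>2" for x y
      unfolding cmod_power2 by (simp add: power2_eq_square algebra_simps)
    show ?thesis
      unfolding square_sum_def re_inner_square_sum_grad[OF V] lin_form_add[OF U V] sq
        sum_subtractf[symmetric]
      by (intro sum.cong refl) (simp add: algebra_simps)
  qed
  define C where "C = (\<Sum>m\<in>M. \<bar>c m\<bar> * (\<Sum>j<r. \<Sum>i<n. cmod (B m i j))\<^sup>2)"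
  have C: "0 \<le> C" unfolding C_def by (intro sum_nonneg) simp
  have bound: "\<bar>?h V\<bar> \<le> C * (re_norm V)\<^sup>2" if V: "V \<in> carrier_mat n r" for V
  proof -
    have "\<bar>?h V\<bar> \<le> (\<Sum>m\<in>M. \<bar>c m * (cmod (?\<phi> m V))\<^sup>2\<bar>)"
      unfolding square_sum_def by (rule sum_abs)
    also have "\<dots> \<le> (\<Sum>m\<in>M. \<bar>c m\<bar> * ((\<Sum>j<r. \<Sum>i<n. cmod (B m i j)) * re_norm V)\<^sup>2)"
      by (intro sum_mono)
        (auto simp: abs_mult intro!: mult_left_mono power_mono cmod_lin_form_le[OF V])
    also have "\<dots> = C * (re_norm V)\<^sup>2"
      unfolding C_def power_mult_distrib
      by (subst sum_distrib_right) (simp only: mult.assoc)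
    finally show ?thesis .
  qed
  have "\<exists>\<delta>>0. \<forall>V\<in>carrier_mat n r. re_norm V < \<delta> \<longrightarrow>
      \<bar>?h (U + V) - ?h U - re_inner ?G V\<bar> \<le> e * re_norm V" if e: "0 < e" for e
  proof (intro exI[of _ "e / (C + 1)"] conjI ballI impI)
    show "0 < e / (C + 1)" using e C by simp
  next
    fix V assume V: "V \<in> carrier_mat n r" and lt: "re_norm V < e / (C + 1)"
    have N: "0 \<le> re_norm V" by (rule re_norm_nonneg[OF V])
    have "C * re_norm V \<le> (C + 1) * re_norm V" using N by (simp add: algebra_simps)
    also have "\<dots> \<le> e" using lt C by (simp add: field_simps)
    finally have "C * re_norm V * re_norm V \<le> e * re_norm V"
      using N by (rule mult_right_mono)
    then show "\<bar>?h (U + V) - ?h U - re_inner ?G V\<bar> \<le> e * re_norm V"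
      using bound[OF V] unfolding rest[OF V] by (simp add: power2_eq_square mult.assoc)
  qed
  then show ?thesis
    unfolding has_gradient_def using square_sum_grad_carrier by blast
qed

text \<open>Euler's identity for a form that is homogeneous of degree 2 over the reals.\<close>

lemma euler_square_sum:
  assumes U: "U \<in> carrier_mat n r"
  shows "re_inner U (gradient n r (square_sum n r M c B) U) = 2 * square_sum n r M c B U"
proof -
  have sq: "Re (cnj z * z) = (cmod z)\<^sup>2" for z
    unfolding cmod_power2 by (simp add: power2_eq_square)
  show ?thesis
    unfolding has_gradient_gradient[OF has_gradient_square_sum[OF U]]
      re_inner_commute[OF U square_sum_grad_carrier] re_inner_square_sum_grad[OF U] sq
      square_sum_def sum_distrib_left
    by (simp add: mult.assoc)
qed

lemma cmod_power2_convex: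
  fixes x y :: complex
  assumes "0 \<le> u" "0 \<le> v" "u + v = 1"
  shows "(cmod (complex_of_real u * x + complex_of_real v * y))\<^sup>2
    \<le> u * (cmod x)\<^sup>2 + v * (cmod y)\<^sup>2"
proof -
  have v: "v = 1 - u" using assms by simp
  \<comment> \<open>The convexity defect is an explicit square.\<close>
  have "u * (cmod x)\<^sup>2 + v * (cmod y)\<^sup>2 - (cmod (complex_of_real u * x + complex_of_real v * y))\<^sup>2
    = u * v * (cmod (x - y))\<^sup>2"
    unfolding cmod_power2 v by (simp add: power2_eq_square algebra_simps)
  moreover have "0 \<le> u * v * (cmod (x - y))\<^sup>2" using assms by simp
  ultimately show ?thesis by linarith
qed

lemma mat_convex_square_sum:
  assumes c: "\<And>m. m \<in> M \<Longrightarrow> 0 \<le> c m"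
  shows "mat_convex n r (square_sum n r M c B)"
  unfolding mat_convex_def
proof (intro ballI allI impI)
  fix X Y :: "complex mat" and u v :: real
  assume X: "X \<in> carrier_mat n r" and Y: "Y \<in> carrier_mat n r"
    and uv: "0 \<le> u" "0 \<le> v" "u + v = 1"
  have "square_sum n r M c B (complex_of_real u \<cdot>\<^sub>m X + complex_of_real v \<cdot>\<^sub>m Y)
      \<le> (\<Sum>m\<in>M. c m * (u * (cmod (lin_form n r (B m) X))\<^sup>2 + v * (cmod (lin_form n r (B m) Y))\<^sup>2))"
    unfolding square_sum_def lin_form_lincomb[OF X Y]
    by (intro sum_mono mult_left_mono cmod_power2_convex uv c)
  also have "\<dots> = u * square_sum n r M c B X + v * square_sum n r M c B Y"
    unfolding square_sum_def sum_distrib_left sum.distrib[symmetric]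
    by (intro sum.cong refl) (simp add: algebra_simps)
  finally show "square_sum n r M c B (complex_of_real u \<cdot>\<^sub>m X + complex_of_real v \<cdot>\<^sub>m Y)
      \<le> u * square_sum n r M c B X + v * square_sum n r M c B Y" .
qed


section \<open>Linearity of iterated mode products in one factor\<close>

text \<open>
  A product along mode \<open>j \<noteq> i\<close> only combines entries whose \<open>i\<close>-th index agrees. So a linear
  dependence on coefficients \<open>x\<close>, valid on the slice where this index equals \<open>k\<close>, survives all
  later products, and the coefficient tensors are transformed along with it.
\<close>

lemma fold_mode_prod_lincomb:
  assumes "i \<notin> set js" and "\<And>p. p ! i = k \<Longrightarrow> T p = (\<Sum>a<n. S a p * x a)" and "p ! i = k"
  shows "fold (\<lambda>j T. mode_prod j T (Xs ! j)) js T p =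
    (\<Sum>a<n. fold (\<lambda>j T. mode_prod j T (Xs ! j)) js (S a) p * x a)"
  using assms
proof (induction js arbitrary: T S)
  case Nil
  then show ?case by simp
next
  case (Cons j js)
  have "mode_prod j T (Xs ! j) q = (\<Sum>a<n. mode_prod j (S a) (Xs ! j) q * x a)"
    if q: "q ! i = k" for q
  proof -
    have "T (q[j := b]) = (\<Sum>a<n. S a (q[j := b]) * x a)" for b
      using Cons.prems(1) q by (intro Cons.prems(2)) simp
    then show ?thesis
      by (simp add: mode_prod_def sum_distrib_right sum_distrib_left)
        (subst sum.swap, simp add: mult_ac)
  qed
  then show ?case
    using Cons.prems(1,3) by (simp add: Cons.IH)
qed

text \<open>
  The coefficient tensors \<open>C a\<close> depend only on the other factors; the factor \<open>X\<close> enters only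
  through its row selected by \<open>p\<close>.
\<close>

lemma mode_prods_linear_in_factor:
  assumes i: "i < length Xs"
  obtains C where "\<And>X p. X \<in> carrier_mat m n \<Longrightarrow> p ! i < m \<Longrightarrow>
    mode_prods A (Xs[i := X]) p = (\<Sum>a<n. C a p * X $$ (p ! i, a))"
proof -
  let ?F = "fold (\<lambda>j T. mode_prod j T (Xs ! j))"
  define B where "B = ?F [0..<i] A"
  define C where "C a = ?F [Suc i..<length Xs] (\<lambda>p. B (p[i := a]))" for a
  have "mode_prods A (Xs[i := X]) p = (\<Sum>a<n. C a p * X $$ (p ! i, a))"
    if X: "X \<in> carrier_mat m n" and p: "p ! i < m" for X p
  proof -
    have other: "fold (\<lambda>j T. mode_prod j T (Xs[i := X] ! j)) js T = ?F js T"
      if "i \<notin> set js" for js T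
      using that by (induction js arbitrary: T) auto
    have "[0..<length Xs] = [0..<i] @ i # [Suc i..<length Xs]"
      using i upt_add_eq_append[of 0 i "length Xs - i"] by (simp add: upt_conv_Cons)
    then have "mode_prods A (Xs[i := X]) = ?F [Suc i..<length Xs] (mode_prod i B X)"
      using i by (simp add: mode_prods_def other B_def)
    moreover have "mode_prod i B X q = (\<Sum>a<n. B (q[i := a]) * X $$ (p ! i, a))"
      if "q ! i = p ! i" for q
      using that X p by (simp add: mode_prod_def)
    ultimately show ?thesis
      unfolding C_def
      using fold_mode_prod_lincomb[where js = "[Suc i..<length Xs]" and i = i and k = "p ! i"
          and T = "mode_prod i B X" and S = "\<lambda>a p. B (p[i := a])"
          and x = "\<lambda>a. X $$ (p ! i, a)" and p = p and n = n and Xs = Xs]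
      by simp
  qed
  then show ?thesis by (rule that)
qed


section \<open>The block functions of the objective\<close>

text \<open>
  The \<open>k\<close>-th diagonal entry sits at a multi-index whose \<open>i\<close>-th component is \<open>k\<close>, so it is a linear
  form in row \<open>k\<close> of \<open>dag U\<close>. In the Hermitian case the conjugation of \<open>U\<close> is moved onto the
  coefficients, which replaces the entry by its conjugate but keeps its modulus.
\<close>

lemma block_fun_diag_objective:
  assumes i: "i < length Us" and dag: "dag = mat_adjoint \<or> dag = transpose_mat"
  obtains B where "\<And>U. U \<in> carrier_mat n r \<Longrightarrow>
    block_fun (diag_objective dag r L w A) i Us U
      = square_sum n r ({..<L} \<times> {..<r}) (\<lambda>(l, k). w l) B U"
proof -
  let ?d = "length Us"
  have "\<exists>C. \<forall>X p. X \<in> carrier_mat r n \<longrightarrow> p ! i < r \<longrightarrow>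
      mode_prods (A l) ((map dag Us)[i := X]) p = (\<Sum>a<n. C a p * X $$ (p ! i, a))" for l
  proof -
    have "i < length (map dag Us)" using i by simp
    then obtain C where "\<And>X p. X \<in> carrier_mat r n \<Longrightarrow> p ! i < r \<Longrightarrow>
        mode_prods (A l) ((map dag Us)[i := X]) p = (\<Sum>a<n. C a p * X $$ (p ! i, a))"
      by (rule mode_prods_linear_in_factor[where m = r and n = n and A = "A l"]) blast
    then show ?thesis by blast
  qed
  then have "\<forall>l. \<exists>C. \<forall>X p. X \<in> carrier_mat r n \<longrightarrow> p ! i < r \<longrightarrow>
      mode_prods (A l) ((map dag Us)[i := X]) p = (\<Sum>a<n. C a p * X $$ (p ! i, a))"
    by (rule allI)
  from choice[OF this] obtain C where C: "\<And>l X p. X \<in> carrier_mat r n \<Longrightarrow> p ! i < r \<Longrightarrow>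
      mode_prods (A l) ((map dag Us)[i := X]) p = (\<Sum>a<n. C l a p * X $$ (p ! i, a))"
    by blast
  \<comment> \<open>In both cases \<open>\<sigma>\<close> is a field automorphism that is its own inverse and preserves the modulus.\<close>
  define \<sigma> :: "complex \<Rightarrow> complex" where "\<sigma> = (if dag = transpose_mat then id else cnj)"
  \<comment> \<open>Only column \<open>k\<close> of \<open>U\<close> contributes to the \<open>k\<close>-th diagonal entry.\<close>
  define B where "B = (\<lambda>(l, k) a j. if j = k then \<sigma> (C l a (replicate ?d k)) else 0)"
  have entry: "cmod (mode_prods (A l) (map dag (Us[i := U])) (replicate ?d k))
      = cmod (lin_form n r (B (l, k)) U)"
    if U: "U \<in> carrier_mat n r" and k: "k < r" for l k U
  proof -
    have dU: "dag U \<in> carrier_mat r n" "\<And>a. a < n \<Longrightarrow> dag U $$ (k, a) = \<sigma> (U $$ (a, k))"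
      using dag U k
      by (auto simp: \<sigma>_def mat_adjoint_def mat_of_rows_def fun_eq_iff split: if_splits)
    have \<sigma>: "\<sigma> (\<Sum>a<n. x a * y a) = (\<Sum>a<n. \<sigma> (x a) * \<sigma> (y a))" "\<sigma> (\<sigma> z) = z" "cmod (\<sigma> z) = cmod z"
      for x y :: "nat \<Rightarrow> complex" and z
      by (auto simp: \<sigma>_def)
    have "mode_prods (A l) (map dag (Us[i := U])) (replicate ?d k)
        = (\<Sum>a<n. C l a (replicate ?d k) * \<sigma> (U $$ (a, k)))"
      using C[OF dU(1), of "replicate ?d k"] i k dU(2) by (simp add: map_update)
    also have "\<dots> = \<sigma> (\<Sum>a<n. \<sigma> (C l a (replicate ?d k)) * U $$ (a, k))"
      by (simp add: \<sigma>)
    also have "(\<Sum>a<n. \<sigma> (C l a (replicate ?d k)) * U $$ (a, k)) = lin_form n r (B (l, k)) U"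
    proof -
      have "lin_form n r (B (l, k)) U =
        (\<Sum>j<r. if j = k then \<Sum>a<n. \<sigma> (C l a (replicate ?d k)) * U $$ (a, k) else 0)"
        unfolding lin_form_def B_def by (intro sum.cong refl) simp
      then show ?thesis using k by simp
    qed
    finally show ?thesis by (simp add: \<sigma>)
  qed
  have "block_fun (diag_objective dag r L w A) i Us U
      = square_sum n r ({..<L} \<times> {..<r}) (\<lambda>(l, k). w l) B U"
    if U: "U \<in> carrier_mat n r" for U
  proof -
    have "(cvec_norm (tensor_diag ?d r (mode_prods (A l) (map dag (Us[i := U])))))\<^sup>2
        = (\<Sum>k<r. (cmod (lin_form n r (B (l, k)) U))\<^sup>2)" for l
      by (simp add: cvec_norm_def tensor_diag_def sum_nonneg entry[OF U])
    then show ?thesis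
      by (simp add: block_fun_def diag_objective_def square_sum_def sum_distrib_left
          sum.cartesian_product case_prod_beta)
  qed
  then show ?thesis by (rule that)
qed

text \<open>
  The gradient and the convexity property see a function only on the carrier, where the block
  function agrees with a quadratic form.
\<close>

lemma has_gradient_cong:
  assumes "\<And>X. X \<in> carrier_mat n r \<Longrightarrow> h X = h' X" and "U \<in> carrier_mat n r"
  shows "has_gradient n r h U G \<longleftrightarrow> has_gradient n r h' U G"
  using assms by (simp add: has_gradient_def cong: ball_cong)

lemma mat_convex_cong:
  assumes "\<And>X. X \<in> carrier_mat n r \<Longrightarrow> h X = h' X"
  shows "mat_convex n r h \<longleftrightarrow> mat_convex n r h'"
  using assms by (simp add: mat_convex_def cong: ball_cong)

theorem proposition5p6:
  fixes ns :: "nat list" and r L :: nat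
    and A :: "nat \<Rightarrow> tensor" and w :: "nat \<Rightarrow> real"
    and dag :: "complex mat \<Rightarrow> complex mat"
  assumes "1 < length ns"
    and "1 \<le> r" and "\<And>i. i < length ns \<Longrightarrow> r \<le> ns ! i"
    and "\<And>l. l < L \<Longrightarrow> A l \<in> carrier_tensor ns"
    and "\<And>l. l < L \<Longrightarrow> 0 \<le> w l"
    and "dag = mat_adjoint \<or> dag = transpose_mat"
  shows "restricted_homogeneous r ns (1/2) (diag_objective dag r L w A)
    \<and> block_multiconvex r ns (diag_objective dag r L w A)"
proof -
  let ?f = "diag_objective dag r L w A"
  let ?q = "\<lambda>n. square_sum n r ({..<L} \<times> {..<r}) (\<lambda>(l, k). w l)"
  have form: "\<exists>B. \<forall>U \<in> carrier_mat (ns ! i) r. block_fun ?f i Us U = ?q (ns ! i) B U"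
    if "i < length ns" "Us \<in> fixed_blocks r ns i" for i Us
  proof -
    have "i < length Us" using that by (simp add: fixed_blocks_def)
    then obtain B where "\<And>U. U \<in> carrier_mat (ns ! i) r \<Longrightarrow> block_fun ?f i Us U = ?q (ns ! i) B U"
      using assms(6)
      by (rule block_fun_diag_objective[where n = "ns ! i" and r = r and L = L and w = w and A = A])
        blast
    then show ?thesis by blast
  qed
  have "(\<exists>G. has_gradient (ns ! i) r (block_fun ?f i Us) U G) \<and>
      block_fun ?f i Us U = 1/2 * re_inner U (gradient (ns ! i) r (block_fun ?f i Us) U)"
    if i: "i < length ns" and Us: "Us \<in> fixed_blocks r ns i" and St: "U \<in> stiefel r (ns ! i)" for i Us U
  proof -
    obtain B where B: "\<And>U. U \<in> carrier_mat (ns ! i) r \<Longrightarrow> block_fun ?f i Us U = ?q (ns ! i) B U"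
      using form[OF i Us] by blast
    have U: "U \<in> carrier_mat (ns ! i) r" using St by (simp add: stiefel_def)
    have eq: "has_gradient (ns ! i) r (block_fun ?f i Us) U = has_gradient (ns ! i) r (?q (ns ! i) B) U"
      by (intro ext has_gradient_cong B U)
    have "gradient (ns ! i) r (block_fun ?f i Us) U = gradient (ns ! i) r (?q (ns ! i) B) U"
      by (simp add: gradient_def eq)
    then show ?thesis
      by (auto simp: eq B[OF U] euler_square_sum[OF U] intro: has_gradient_square_sum[OF U])
  qed
  then have "restricted_homogeneous r ns (1/2) ?f"
    by (simp add: restricted_homogeneous_def Let_def)
  moreover have "mat_convex (ns ! i) r (block_fun ?f i Us)"
    if i: "i < length ns" and Us: "Us \<in> fixed_blocks r ns i" for i Us
  proof -
    obtain B where B: "\<And>U. U \<in> carrier_mat (ns ! i) r \<Longrightarrow> block_fun ?f i Us U = ?q (ns ! i) B U"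
      using form[OF i Us] by blast
    have "mat_convex (ns ! i) r (?q (ns ! i) B)"
      using assms(5) by (intro mat_convex_square_sum) auto
    then show ?thesis by (rule iffD2[OF mat_convex_cong, rotated]) (rule B)
  qed
  then have "block_multiconvex r ns ?f" by (simp add: block_multiconvex_def)
  ultimately show ?thesis ..
qed

end
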